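(* The $3$-graph $F_5$ is not $(2,1/2)$-vertex-extendable with respect to $\mathfrak{K}_3^3$, where $\mathfrak{K}_3^3$ is the collection of all $3$-partite $3$-graphs.
   Context: A $3$-graph $\mathcal{H}$ consists of a finite vertex set $V(\mathcal{H})$ and a collection of $3$-subsets of $V(\mathcal{H})$ (its edges). $F_5$ is the $3$-graph on vertex set $\{1,2,3,4,5\}$ with edges $\{1,2,3\},\{1,2,4\},\{3,4,5\}$. A $3$-graph is $F_5$-free if it contains no copy of $F_5$ as a (not necessarily induced) subgraph. A $3$-graph is $3$-partite if its vertex set can be partitioned into three parts so that every edge contains exactly one vertex from each part. For $T\subset V(\mathcal{H})$, $d_{\mathcal{H}}(T)$ is the number of edges containing $T$. For real $p>0$, $\|\mathcal{H}\|_{2,p}:=\sum_{T\in\binom{V(\mathcal{H})}{2}}d_{\mathcal{H}}(T)^p$. The $(2,p)$-degree of a vertex $v$ is $\|\mathcal{H}\|_{2,p}-\|\mathcal{H}-v\|_{2,p}$, where $\mathcal{H}-v$ is obtained by removing $v$ and all edges containing it; $\delta_{2,p}(\mathcal{H})$ is the minimum $(2,p)$-degree. $\mathrm{ex}_{2,p}(n,F_5)$ is the maximum of $\|\mathcal{H}\|_{2,p}$ over $n$-vertex $F_5$-free $3$-graphs, and $\mathrm{exdeg}_{2,p}(n,F_5):=(2+p)\cdot\mathrm{ex}_{2,p}(n,F_5)/n$. For a family $\mathfrak{H}$ of $F_5$-free $3$-graphs closed under taking subgraphs, $F_5$ is $(2,p)$-vertex-extendable with respect to $\mathfrak{H}$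 if there exist $\varepsilon>0$ and $N_0$ such that the following holds for every $F_5$-free $3$-graph $\mathcal{H}$ on $n\ge N_0$ vertices with $\delta_{2,p}(\mathcal{H})\ge(1-\varepsilon)\cdot\mathrm{exdeg}_{2,p}(n,F_5)$: if $\mathcal{H}-v\in\mathfrak{H}$ for some $v\in V(\mathcal{H})$, then $\mathcal{H}\in\mathfrak{H}$. *)

theory Defs
  imports Complex_Main
begin

record 'a hypergraph =
  verts :: "'a set"
  edges :: "'a set set"

definition three_graph :: "'a hypergraph \<Rightarrow> bool" where
  "three_graph H \<longleftrightarrow> finite (verts H) \<and> (\<forall>e\<in>edges H. e \<subseteq> verts H \<and> card e = 3)"

definition contains_copy :: "'b hypergraph \<Rightarrow> 'a hypergraph \<Rightarrow> bool" where
  "contains_copy F H \<longleftrightarrow>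
     (\<exists>f. inj_on f (verts F) \<and> f ` verts F \<subseteq> verts H \<and> (\<forall>e\<in>edges F. f ` e \<in> edges H))"

definition F5 :: "nat hypergraph" where
  "F5 = \<lparr>verts = {1, 2, 3, 4, 5}, edges = {{1, 2, 3}, {1, 2, 4}, {3, 4, 5}}\<rparr>"

text \<open>Parts of the partition may be empty, so that the 3-partite 3-graphs are closed
  under taking subgraphs.\<close>

definition three_partite :: "'a hypergraph \<Rightarrow> bool" where
  "three_partite H \<longleftrightarrow>
     (\<exists>A B C. A \<union> B \<union> C = verts H \<and> A \<inter> B = {} \<and> A \<inter> C = {} \<and> B \<inter> C = {} \<and>
        (\<forall>e\<in>edges H. card (e \<inter> A) = 1 \<and> card (e \<inter> B) = 1 \<and> card (e \<inter> C) = 1))"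

definition three_partite_graphs :: "'a hypergraph set" where
  "three_partite_graphs = {H. three_graph H \<and> three_partite H}"

definition deg :: "'a hypergraph \<Rightarrow> 'a set \<Rightarrow> nat" where
  "deg H T = card {e \<in> edges H. T \<subseteq> e}"

definition norm2 :: "real \<Rightarrow> 'a hypergraph \<Rightarrow> real" where
  "norm2 p H = (\<Sum>T | T \<subseteq> verts H \<and> card T = 2. real (deg H T) powr p)"

definition remove_vertex :: "'a hypergraph \<Rightarrow> 'a \<Rightarrow> 'a hypergraph" where
  "remove_vertex H v = \<lparr>verts = verts H - {v}, edges = {e \<in> edges H. v \<notin> e}\<rparr>"

definition degree2 :: "real \<Rightarrow> 'a hypergraph \<Rightarrow> 'a \<Rightarrow> real" where
  "degree2 p H v = norm2 p H - norm2 p (remove_vertex H v)"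

definition min_degree2 :: "real \<Rightarrow> 'a hypergraph \<Rightarrow> real" where
  "min_degree2 p H = Min (degree2 p H ` verts H)"

text \<open>From here on the vertices of the host 3-graphs are natural numbers. This loses no
  generality, as every finite 3-graph is isomorphic to one of these. The maximum below
  ranges over finitely many values: \<open>norm2 p H\<close> only depends on how many pairs have
  each of the possible degrees \<open>0, \<dots>, n - 2\<close>.\<close>

definition ex2 :: "real \<Rightarrow> nat \<Rightarrow> 'b hypergraph \<Rightarrow> real" where
  "ex2 p n F =
     Max {norm2 p H | H :: nat hypergraph. three_graph H \<and> card (verts H) = n \<and> \<not> contains_copy F H}"

definition exdeg2 :: "real \<Rightarrow> nat \<Rightarrow> 'b hypergraph \<Rightarrow> real" where
  "exdeg2 p n F = (2 + p) * ex2 p n F / real n"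

definition vertex_extendable2 :: "real \<Rightarrow> 'b hypergraph \<Rightarrow> nat hypergraph set \<Rightarrow> bool" where
  "vertex_extendable2 p F \<HH> \<longleftrightarrow>
     (\<exists>\<epsilon>>0. \<exists>N\<^sub>0::nat. \<forall>H :: nat hypergraph.
        three_graph H \<and> \<not> contains_copy F H \<and> card (verts H) \<ge> N\<^sub>0 \<and>
        min_degree2 p H \<ge> (1 - \<epsilon>) * exdeg2 p (card (verts H)) F \<and>
        (\<exists>v\<in>verts H. remove_vertex H v \<in> \<HH>)
        \<longrightarrow> H \<in> \<HH>)"

end

(*
  Upper bound. For an edge abc of an F5-free 3-graph, N(bc) is disjoint from the set of the D(a)
  vertices whose codegree with a is at least 3. Hence S(a)^2 <= 2 D(a) sqrt(n - D(a)) R(a), where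
  S(a) sums sqrt d(ay) over those vertices y, and R(a) sums 1 / sqrt d(bc) over the link of a. With
  m = n/3, D sqrt(n - D) is at most 2 m^(3/2), while R sums to the norm and S to twice the norm up to
  O(n^2). Cauchy-Schwarz then bounds the norm by n m^(3/2) + O(n^2), the value of the balanced
  complete 3-partite 3-graph.

  Counterexample. In the balanced complete 3-partite 3-graph, add two vertices u, w whose links are
  disjoint sets of about q^(3/2) pairs between the second and third part (q the size of the parts),
  and remove these pairs from all other links. A pair of codegree 1 contributes 1 to the degree of its
  only neighbour, so u and w have large degree although their links are sparse. Because their links
  are disjoint, adding a single edge uvw with v in the second part creates no F5, but it destroys
  3-partiteness.
*)
theory Submission
  imports Defs "HOL-Analysis.Convex" "HOL-Real_Asymp.Real_Asymp" "HOL-Library.Nat_Bijection"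
begin

subsection \<open>The norm as a sum over edges\<close>

definition pairs :: "'a hypergraph \<Rightarrow> 'a set set" where
  "pairs H = {T. T \<subseteq> verts H \<and> card T = 2}"

lemma finite_verts: "three_graph H \<Longrightarrow> finite (verts H)"
  and finite_edge: "three_graph H \<Longrightarrow> e \<in> edges H \<Longrightarrow> finite e"
  and finite_edges: "three_graph H \<Longrightarrow> finite (edges H)"
  and finite_pairs: "three_graph H \<Longrightarrow> finite (pairs H)"
proof -
  show "three_graph H \<Longrightarrow> finite (verts H)"
    by (simp add: three_graph_def)
  show "three_graph H \<Longrightarrow> e \<in> edges H \<Longrightarrow> finite e"
    by (auto simp: three_graph_def intro: finite_subset)
  show "three_graph H \<Longrightarrow> finite (edges H)"
    by (rule finite_subset[of _ "Pow (verts H)"]) (auto simp: three_graph_def)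
  show "three_graph H \<Longrightarrow> finite (pairs H)"
    by (rule finite_subset[of _ "Pow (verts H)"]) (auto simp: three_graph_def pairs_def)
qed

lemma edge_subset: "three_graph H \<Longrightarrow> e \<in> edges H \<Longrightarrow> e \<subseteq> verts H"
  and edge_card: "three_graph H \<Longrightarrow> e \<in> edges H \<Longrightarrow> card e = 3"
  by (auto simp: three_graph_def)

lemma norm2_half: "norm2 (1/2) H = (\<Sum>T\<in>pairs H. sqrt (deg H T))"
  by (simp add: norm2_def pairs_def powr_half_sqrt)

lemma card_2_subsets_of_3:
  assumes "card e = 3"
  shows "bij_betw (\<lambda>a. e - {a}) e {T. T \<subseteq> e \<and> card T = 2}"
proof (rule bij_betw_imageI)
  have fin: "finite e" using assms by (metis card.infinite zero_neq_numeral)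
  show "inj_on (\<lambda>a. e - {a}) e" by (auto simp: inj_on_def)
  show "(\<lambda>a. e - {a}) ` e = {T. T \<subseteq> e \<and> card T = 2}"
  proof safe
    fix a assume "a \<in> e" then show "card (e - {a}) = 2" using assms fin by simp
  next
    fix T assume T: "T \<subseteq> e" "card T = 2"
    then have "card (e - T) = 1" using assms fin by (simp add: card_Diff_subset finite_subset)
    then obtain a where "e - T = {a}" by (auto simp: card_1_singleton_iff)
    then show "T \<in> (\<lambda>a. e - {a}) ` e" using T by (intro image_eqI[of _ _ a]) auto
  qed
qed

lemma link_of_pair:
  assumes H: "three_graph H" and T: "card T = 2"
  shows "bij_betw (\<lambda>x. insert x T) {x. x \<notin> T \<and> insert x T \<in> edges H} {e \<in> edges H. T \<subseteq> e}"
proof (rule bij_betw_imageI)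
  have finT: "finite T" using T by (metis card.infinite zero_neq_numeral)
  show "inj_on (\<lambda>x. insert x T) {x. x \<notin> T \<and> insert x T \<in> edges H}"
    by (auto simp: inj_on_def)
  show "(\<lambda>x. insert x T) ` {x. x \<notin> T \<and> insert x T \<in> edges H} = {e \<in> edges H. T \<subseteq> e}"
  proof safe
    fix e assume e: "e \<in> edges H" "T \<subseteq> e"
    then have "card (e - T) = 1"
      using edge_card[OF H e(1)] finite_edge[OF H e(1)] T finT by (simp add: card_Diff_subset)
    then obtain a where "e - T = {a}" by (auto simp: card_1_singleton_iff)
    then have "e = insert a T" "a \<notin> T" using e by auto
    then show "e \<in> (\<lambda>x. insert x T) ` {x. x \<notin> T \<and> insert x T \<in> edges H}" using e by auto
  qed
qed

lemma deg_eq_card_link: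
  assumes "three_graph H" and "card T = 2"
  shows "deg H T = card {x. x \<notin> T \<and> insert x T \<in> edges H}"
  unfolding deg_def using bij_betw_same_card[OF link_of_pair[OF assms]] by simp

lemma sum_pairs_through:
  assumes "finite V" and "a \<in> V"
  shows "(\<Sum>T | T \<subseteq> V \<and> card T = 2 \<and> a \<in> T. f T) = (\<Sum>y\<in>V - {a}. f {a, y})"
proof -
  have "{T. T \<subseteq> V \<and> card T = 2 \<and> a \<in> T} = (\<lambda>y. {a, y}) ` (V - {a})"
    using assms by (auto simp: card_2_iff)
  moreover have "inj_on (\<lambda>y. {a, y}) (V - {a})" by (auto simp: inj_on_def doubleton_eq_iff)
  ultimately show ?thesis by (simp add: sum.reindex)
qed

lemma sum_ordered_pairs:
  fixes f :: "'a set \<Rightarrow> real"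
  assumes fin: "finite V"
  shows "(\<Sum>a\<in>V. \<Sum>y\<in>V - {a}. f {a, y}) = 2 * (\<Sum>T | T \<subseteq> V \<and> card T = 2. f T)"
proof -
  have finP: "finite {T. T \<subseteq> V \<and> card T = 2}" using fin by simp
  have "(\<Sum>a\<in>V. \<Sum>y\<in>V - {a}. f {a, y}) = (\<Sum>a\<in>V. \<Sum>T | T \<in> {T. T \<subseteq> V \<and> card T = 2} \<and> a \<in> T. f T)"
    by (rule sum.cong) (auto simp: sum_pairs_through[OF fin, symmetric] conj_assoc)
  also have "\<dots> = (\<Sum>T | T \<subseteq> V \<and> card T = 2. \<Sum>a | a \<in> V \<and> a \<in> T. f T)"
    by (rule sum.swap_restrict[OF fin finP])
  also have "\<dots> = (\<Sum>T | T \<subseteq> V \<and> card T = 2. 2 * f T)"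
  proof (rule sum.cong[OF refl])
    fix T assume T: "T \<in> {T. T \<subseteq> V \<and> card T = 2}"
    then have "{a. a \<in> V \<and> a \<in> T} = T" by auto
    then show "(\<Sum>a | a \<in> V \<and> a \<in> T. f T) = 2 * f T" using T by simp
  qed
  finally show ?thesis by (simp add: sum_distrib_left)
qed

text \<open>A pair of degree \<open>d > 0\<close> spreads its weight \<open>sqrt d\<close> evenly
  over its \<open>d\<close> edges, \<open>1 / sqrt d\<close> each; pairs of degree 0 weigh nothing
  on either side. The three pairs inside an edge are indexed by the vertex they omit, which turns
  the norm into a sum over vertex links.\<close>

lemma norm2_half_eq_sum_edges:
  assumes H: "three_graph H"
  shows "norm2 (1/2) H = (\<Sum>a\<in>verts H. \<Sum>e | e \<in> edges H \<and> a \<in> e. 1 / sqrt (deg H (e - {a})))"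
proof -
  have "norm2 (1/2) H = (\<Sum>T\<in>pairs H. \<Sum>e | e \<in> edges H \<and> T \<subseteq> e. 1 / sqrt (deg H T))"
    unfolding norm2_half by (rule sum.cong) (auto simp: deg_def real_div_sqrt)
  also have "\<dots> = (\<Sum>e\<in>edges H. \<Sum>T | T \<in> pairs H \<and> T \<subseteq> e. 1 / sqrt (deg H T))"
    by (rule sum.swap_restrict) (simp_all add: H finite_pairs finite_edges)
  also have "\<dots> = (\<Sum>e\<in>edges H. \<Sum>a | a \<in> verts H \<and> a \<in> e. 1 / sqrt (deg H (e - {a})))"
  proof (rule sum.cong[OF refl])
    fix e assume e: "e \<in> edges H"
    have 1: "{T. T \<in> pairs H \<and> T \<subseteq> e} = {T. T \<subseteq> e \<and> card T = 2}"
      and 2: "{a. a \<in> verts H \<and> a \<in> e} = e"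
      using edge_subset[OF H e] by (auto simp: pairs_def)
    show "(\<Sum>T | T \<in> pairs H \<and> T \<subseteq> e. 1 / sqrt (deg H T))
        = (\<Sum>a | a \<in> verts H \<and> a \<in> e. 1 / sqrt (deg H (e - {a})))"
      unfolding 1 2
      by (rule sum.reindex_bij_betw[symmetric, OF card_2_subsets_of_3[OF edge_card[OF H e]]])
  qed
  also have "\<dots> = (\<Sum>a\<in>verts H. \<Sum>e | e \<in> edges H \<and> a \<in> e. 1 / sqrt (deg H (e - {a})))"
    by (rule sum.swap_restrict) (simp_all add: H finite_verts finite_edges)
  finally show ?thesis .
qed

text \<open>The handshake lemma for the link graph of \<open>a\<close>, whose edges are the sets
  \<open>e - {a}\<close>.\<close>

lemma sum_deg_pairs_through:
  assumes H: "three_graph H" and a: "a \<in> verts H"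
  shows "(\<Sum>y\<in>verts H - {a}. deg H {a, y}) = 2 * card {e \<in> edges H. a \<in> e}"
proof -
  let ?E = "{e \<in> edges H. a \<in> e}"
  have "(\<Sum>y\<in>verts H - {a}. deg H {a, y}) = (\<Sum>y\<in>verts H - {a}. \<Sum>e | e \<in> ?E \<and> y \<in> e. 1)"
    by (simp add: deg_def conj_assoc)
  also have "\<dots> = (\<Sum>e\<in>?E. \<Sum>y | y \<in> verts H - {a} \<and> y \<in> e. 1)"
    by (rule sum.swap_restrict) (simp_all add: H finite_verts finite_edges)
  also have "\<dots> = (\<Sum>e\<in>?E. 2)"
  proof (rule sum.cong[OF refl])
    fix e assume e: "e \<in> ?E"
    then have "{y. y \<in> verts H - {a} \<and> y \<in> e} = e - {a}" using edge_subset[OF H] by auto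
    then show "(\<Sum>y | y \<in> verts H - {a} \<and> y \<in> e. 1) = (2::nat)"
      using e edge_card[OF H] finite_edge[OF H] by simp
  qed
  finally show ?thesis by simp
qed

subsection \<open>The upper bound for F5-free 3-graphs\<close>

text \<open>A vertex \<open>x\<close> in both sets would give the copy \<open>bca, bcx, axy\<close> of \<open>F5\<close>; the threshold 3
  leaves room for some \<open>y \<notin> {b, c}\<close>.\<close>

lemma F5_free_codegree_bound:
  assumes H: "three_graph H" and free: "\<not> contains_copy F5 H"
    and e: "e \<in> edges H" "a \<in> e"
  shows "deg H (e - {a}) + card {x \<in> verts H - {a}. deg H {a, x} \<ge> 3} \<le> card (verts H)"
proof -
  let ?T = "e - {a}"
  let ?M = "{x. x \<notin> ?T \<and> insert x ?T \<in> edges H}"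
  let ?N = "{x \<in> verts H - {a}. deg H {a, x} \<ge> 3}"
  have finV: "finite (verts H)" by (rule finite_verts[OF H])
  have T: "card ?T = 2" using edge_card[OF H e(1)] finite_edge[OF H e(1)] e(2) by simp
  then obtain b c where bc: "?T = {b, c}" "b \<noteq> c" by (auto simp: card_2_iff)
  have abc: "{b, c, a} = e" "a \<noteq> b" "a \<noteq> c" using bc e by auto
  have "?M \<subseteq> verts H" using edge_subset[OF H] by auto
  have "?M \<inter> ?N = {}"
  proof (rule ccontr)
    assume "?M \<inter> ?N \<noteq> {}"
    then obtain x where x: "x \<notin> {b, c}" "{x, b, c} \<in> edges H" "x \<noteq> a" "deg H {a, x} \<ge> 3"
      by (auto simp: bc(1))
    let ?Y = "{y. y \<notin> {a, x} \<and> insert y {a, x} \<in> edges H}"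
    have "card ?Y \<ge> 3" using deg_eq_card_link[OF H, of "{a, x}"] x by simp
    moreover have "card ?Y \<le> 2" if "?Y \<subseteq> {b, c}"
      using card_mono[OF _ that] bc(2) by simp
    ultimately have "\<not> ?Y \<subseteq> {b, c}" by linarith
    then obtain y where y: "y \<notin> {a, x}" "insert y {a, x} \<in> edges H" "y \<notin> {b, c}" by blast
    define f where "f = (\<lambda>i::nat. if i = 1 then b else if i = 2 then c else if i = 3 then a
                                 else if i = 4 then x else y)"
    have sub: "{b, c, a} \<subseteq> verts H" "{x, b, c} \<subseteq> verts H" "insert y {a, x} \<subseteq> verts H"
      using edge_subset[OF H] x(2) y(2) e(1) abc(1) by blast+
    have "contains_copy F5 H"
      unfolding contains_copy_def
    proof (intro exI[of _ f] conjI)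
      show "inj_on f (verts F5)"
        using x y bc(2) abc by (auto simp: F5_def f_def inj_on_def)
      show "f ` verts F5 \<subseteq> verts H" using sub by (auto simp: F5_def f_def)
      show "\<forall>e\<in>edges F5. f ` e \<in> edges H"
        using x(2) y(2) e(1) abc(1) by (auto simp: F5_def f_def insert_commute)
    qed
    with free show False by simp
  qed
  then have "card ?M + card ?N = card (?M \<union> ?N)"
    using finV \<open>?M \<subseteq> verts H\<close> by (subst card_Un_disjoint) (auto intro: finite_subset)
  also have "\<dots> \<le> card (verts H)" using \<open>?M \<subseteq> verts H\<close> by (intro card_mono finV) auto
  finally show ?thesis using deg_eq_card_link[OF H T] by simp
qed

text \<open>The maximum is attained at \<open>x = 2 * m\<close>. After squaring, the difference of
  the two sides factors with a double root there.\<close>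

lemma mult_sqrt_diff_le:
  fixes x m :: real
  assumes "0 \<le> x" "x \<le> 3 * m"
  shows "x * sqrt (3 * m - x) \<le> 2 * m * sqrt m"
proof -
  have "(2 * m)\<^sup>2 * m - x\<^sup>2 * (3 * m - x) = (x - 2 * m)\<^sup>2 * (x + m)"
    by (simp add: power2_eq_square algebra_simps)
  also have "\<dots> \<ge> 0" using assms by simp
  finally have "sqrt (x\<^sup>2 * (3 * m - x)) \<le> sqrt ((2 * m)\<^sup>2 * m)" by simp
  then show ?thesis using assms by (simp add: real_sqrt_mult)
qed

text \<open>Solves the quadratic inequality \<open>(X - s)^2 <= c * X\<close> by dropping
  \<open>s^2\<close> and dividing by \<open>X\<close>. Below, \<open>X\<close> is the norm,
  \<open>c\<close> the main term and \<open>s\<close> the quadratic error.\<close>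

lemma le_from_shifted_square:
  fixes X c s S :: real
  assumes "0 \<le> c" "0 \<le> s" "0 \<le> X" and S: "2 * (X - s) \<le> S" "S\<^sup>2 \<le> 4 * c * X"
  shows "X \<le> c + 2 * s"
proof (cases "X \<le> s")
  case True
  then show ?thesis using assms(1,2) by linarith
next
  case False
  then have "(2 * (X - s))\<^sup>2 \<le> S\<^sup>2" using S(1) by (intro power_mono) auto
  then have "4 * (X * X) + 4 * (s * s) \<le> 4 * ((c + 2 * s) * X)"
    using S(2) by (simp add: power2_eq_square algebra_simps)
  then have "X * X \<le> (c + 2 * s) * X"
    using zero_le_square[of s] by linarith
  moreover have "X > 0" using False assms(2) by linarith
  ultimately show ?thesis by (rule mult_right_le_imp_le)
qed

lemma F5_free_norm2_half_le:
  fixes H :: "'a hypergraph"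
  assumes H: "three_graph H" and free: "\<not> contains_copy F5 H" and n: "card (verts H) = n"
  shows "norm2 (1/2) H \<le> n * ((n / 3) * sqrt (n / 3)) + 2 * (real n)\<^sup>2"
proof -
  let ?V = "verts H"
  define m where "m = real n / 3"
  define X where "X = norm2 (1/2) H"
  define E where "E a = {e. e \<in> edges H \<and> a \<in> e}" for a
  define N where "N a = {x \<in> ?V - {a}. deg H {a, x} \<ge> 3}" for a
  define R where "R a = (\<Sum>e\<in>E a. 1 / sqrt (deg H (e - {a})))" for a
  define S where "S a = (\<Sum>y\<in>N a. sqrt (deg H {a, y}))" for a
  have finV: "finite ?V" by (rule finite_verts[OF H])
  have finE: "finite (E a)" for a using finite_edges[OF H] by (simp add: E_def)
  have m0: "m \<ge> 0" by (simp add: m_def)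
  have X0: "X \<ge> 0" by (simp add: X_def norm2_def sum_nonneg)
  have XR: "X = (\<Sum>a\<in>?V. R a)"
    unfolding X_def R_def E_def by (rule norm2_half_eq_sum_edges[OF H])
  have SR: "(S a)\<^sup>2 \<le> 4 * (m * sqrt m) * R a" if a: "a \<in> ?V" for a
  proof (cases "E a = {}")
    \<comment> \<open>Without edges at \<open>a\<close> both sides vanish. The other case needs an
      edge to get \<open>D < n\<close>, so that dividing by \<open>sqrt (n - D)\<close> is
      legitimate.\<close>
    case True
    have "(\<Sum>y\<in>?V - {a}. deg H {a, y}) = 0"
      unfolding sum_deg_pairs_through[OF H a] True[unfolded E_def] by simp
    then have "N a = {}" using finV by (auto simp: N_def)
    then show ?thesis using True by (simp add: S_def R_def)
  next
    case False
    define D where "D = card (N a)"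
    have dn: "deg H (e - {a}) + D \<le> n" if "e \<in> E a" for e
      using F5_free_codegree_bound[OF H free, of e a] that n by (simp add: E_def D_def N_def)
    have dpos: "deg H (e - {a}) > 0" if "e \<in> E a" for e
      using that finite_edges[OF H] by (auto simp: E_def deg_def card_gt_0_iff)
    have Dn: "D < n" using False dn dpos by fastforce
    \<comment> \<open>All pairs in the link of \<open>a\<close> have degree at most
      \<open>n - D\<close>, so each edge at \<open>a\<close> contributes at least
      \<open>1 / sqrt (n - D)\<close> to \<open>R a\<close>. This bounds the number of these edges
      by \<open>R a\<close>.\<close>
    have "card (E a) / sqrt (n - real D) = (\<Sum>e\<in>E a. 1 / sqrt (n - real D))" by simp
    also have "\<dots> \<le> R a"
      unfolding R_def
    proof (rule sum_mono)
      fix e assume "e \<in> E a"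
      with dn[of e] dpos[of e] Dn show "1 / sqrt (n - real D) \<le> 1 / sqrt (deg H (e - {a}))"
        by (intro divide_left_mono) (auto intro!: mult_pos_pos)
    qed
    finally have ER: "card (E a) \<le> sqrt (n - real D) * R a" using Dn by (simp add: field_simps)
    have R0: "R a \<ge> 0" by (simp add: R_def sum_nonneg)
    \<comment> \<open>Cauchy-Schwarz against the constant 1 on \<open>N a\<close> gives the factor
      \<open>D\<close>; the handshake identity then turns the sum of codegrees into the number of
      edges at \<open>a\<close>.\<close>
    have "(S a)\<^sup>2 \<le> (\<Sum>y\<in>N a. 1\<^sup>2) * (\<Sum>y\<in>N a. (sqrt (deg H {a, y}))\<^sup>2)"
      unfolding S_def using Cauchy_Schwarz_ineq_sum[of "\<lambda>_. 1" "\<lambda>y. sqrt (deg H {a, y})" "N a"] by simp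
    also have "\<dots> = D * real (\<Sum>y\<in>N a. deg H {a, y})" by (simp add: D_def)
    also have "\<dots> \<le> D * real (\<Sum>y\<in>?V - {a}. deg H {a, y})"
      using finV by (intro mult_left_mono of_nat_mono sum_mono2) (auto simp: N_def)
    also have "\<dots> = 2 * D * real (card (E a))"
      unfolding sum_deg_pairs_through[OF H a] by (simp add: E_def)
    also have "\<dots> \<le> 2 * D * (sqrt (n - real D) * R a)"
      using ER by (intro mult_left_mono) auto
    also have "\<dots> = 2 * (D * sqrt (3 * m - D)) * R a" by (simp add: m_def)
    also have "\<dots> \<le> 2 * (2 * m * sqrt m) * R a"
      using mult_sqrt_diff_le[of D m] Dn R0 by (intro mult_right_mono mult_left_mono) (auto simp: m_def)
    finally show ?thesis by simp
  qed
  have "2 * X = (\<Sum>a\<in>?V. \<Sum>y\<in>?V - {a}. sqrt (deg H {a, y}))"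
    using sum_ordered_pairs[OF finV, of "\<lambda>T. sqrt (deg H T)"] by (simp add: X_def norm2_half pairs_def)
  also have "\<dots> \<le> (\<Sum>a\<in>?V. S a + 2 * n)"
  proof (rule sum_mono)
    fix a assume a: "a \<in> ?V"
    have "(\<Sum>y\<in>?V - {a}. sqrt (deg H {a, y})) = (\<Sum>y\<in>(?V - {a}) - N a. sqrt (deg H {a, y})) + S a"
      unfolding S_def using finV by (intro sum.subset_diff) (auto simp: N_def)
    \<comment> \<open>Outside \<open>N a\<close> codegrees are at most 2, so the crude bound 2 on
      their roots costs only \<open>2 * n\<close> per vertex, of lower order than the main
      term.\<close>
    also have "(\<Sum>y\<in>(?V - {a}) - N a. sqrt (deg H {a, y})) \<le> (\<Sum>y\<in>(?V - {a}) - N a. 2)"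
    proof (rule sum_mono)
      fix y assume "y \<in> (?V - {a}) - N a"
      then have "real (deg H {a, y}) \<le> 4" by (auto simp: N_def)
      then show "sqrt (deg H {a, y}) \<le> 2" by (intro real_le_lsqrt) auto
    qed
    also have "\<dots> \<le> 2 * n"
      using finV card_mono[OF finV, of "?V - {a} - N a"] n by auto
    finally show "(\<Sum>y\<in>?V - {a}. sqrt (deg H {a, y})) \<le> S a + 2 * n" by simp
  qed
  also have "\<dots> = (\<Sum>a\<in>?V. S a) + 2 * (real n)\<^sup>2"
    by (simp add: sum.distrib n power2_eq_square)
  finally have XS: "2 * (X - (real n)\<^sup>2) \<le> (\<Sum>a\<in>?V. S a)" by simp
  \<comment> \<open>A second Cauchy-Schwarz, now over the vertices; the values \<open>R a\<close>
    then add up to \<open>X\<close> itself, which makes the estimate self-bounding.\<close>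
  have "(\<Sum>a\<in>?V. S a)\<^sup>2 \<le> n * (\<Sum>a\<in>?V. (S a)\<^sup>2)"
    using Cauchy_Schwarz_ineq_sum[of "\<lambda>_. 1" S ?V] n by simp
  also have "\<dots> \<le> n * (\<Sum>a\<in>?V. 4 * (m * sqrt m) * R a)"
    using SR by (intro mult_left_mono sum_mono) auto
  also have "\<dots> = 4 * (n * (m * sqrt m)) * X" by (simp add: XR flip: sum_distrib_left)
  finally have SX: "(\<Sum>a\<in>?V. S a)\<^sup>2 \<le> 4 * (n * (m * sqrt m)) * X" .
  have "X \<le> n * (m * sqrt m) + 2 * (real n)\<^sup>2"
    by (rule le_from_shifted_square[OF _ _ X0 XS SX]) (use m0 in auto)
  then show ?thesis by (simp add: X_def m_def)
qed

section \<open>Finiteness of the set of norm values and bounds on the extremal number\<close>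

lemma norm2_eq_sum_levels:
  assumes H: "three_graph H" and n: "card (verts H) = n"
  shows "norm2 p H = (\<Sum>j\<le>2 ^ n. real (card {T \<in> pairs H. deg H T = j}) * real j powr p)"
    and "card {T \<in> pairs H. deg H T = j} \<le> 2 ^ n"
proof -
  have fin: "finite (verts H)" by (rule finite_verts[OF H])
  have cE: "card (edges H) \<le> 2 ^ n"
    unfolding n[symmetric] card_Pow[OF fin, symmetric]
    using fin edge_subset[OF H] by (intro card_mono) auto
  show "card {T \<in> pairs H. deg H T = j} \<le> 2 ^ n"
    unfolding n[symmetric] card_Pow[OF fin, symmetric]
    using fin by (intro card_mono) (auto simp: pairs_def)
  have "deg H T \<le> 2 ^ n" for T
  proof -
    have "deg H T \<le> card (edges H)"
      unfolding deg_def by (intro card_mono finite_edges[OF H]) auto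
    then show ?thesis using cE by (rule order_trans)
  qed
  then have "deg H ` pairs H \<subseteq> {..2 ^ n}" by auto
  then have "norm2 p H = (\<Sum>j\<le>2 ^ n. \<Sum>T | T \<in> pairs H \<and> deg H T = j. real (deg H T) powr p)"
    unfolding norm2_def pairs_def[symmetric]
    by (intro sum.group[symmetric] finite_pairs[OF H]) auto
  then show "norm2 p H = (\<Sum>j\<le>2 ^ n. real (card {T \<in> pairs H. deg H T = j}) * real j powr p)"
    by simp
qed

text \<open>Needed to reason about \<open>Max\<close> in \<open>ex2\<close>: over the natural
  numbers there are infinitely many host 3-graphs. The norm is determined by the number of pairs at
  each degree, hence by one of finitely many functions. The bound \<open>2 ^ n\<close> is crude
  since only finiteness matters.\<close>

lemma finite_norm2_values:
  "finite {norm2 p H | H :: 'a hypergraph. three_graph H \<and> card (verts H) = n \<and> Q H}"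
proof (rule finite_subset)
  let ?K = "2 ^ n :: nat"
  let ?F = "Pi\<^sub>E {..?K} (\<lambda>_. {..2 ^ n :: nat})"
  show "finite ((\<lambda>c. \<Sum>j\<le>?K. real (c j) * real j powr p) ` ?F)"
    by (intro finite_imageI finite_PiE) auto
  show "{norm2 p H | H :: 'a hypergraph. three_graph H \<and> card (verts H) = n \<and> Q H}
      \<subseteq> (\<lambda>c. \<Sum>j\<le>?K. real (c j) * real j powr p) ` ?F"
  proof safe
    fix H :: "'a hypergraph" assume H: "three_graph H" "n = card (verts H)"
    define c where "c = (\<lambda>j\<in>{..?K}. card {T \<in> pairs H. deg H T = j})"
    have "c \<in> ?F" using norm2_eq_sum_levels(2)[OF H(1) H(2)[symmetric]] by (simp add: c_def)
    moreover have "norm2 p H = (\<Sum>j\<le>?K. real (c j) * real j powr p)"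
      unfolding norm2_eq_sum_levels(1)[OF H(1) H(2)[symmetric]] by (intro sum.cong) (auto simp: c_def)
    ultimately show "norm2 p H \<in> (\<lambda>c. \<Sum>j\<le>2 ^ card (verts H). real (c j) * real j powr p) `
        (Pi\<^sub>E {..2 ^ card (verts H)} (\<lambda>_. {..2 ^ card (verts H)}))" using H(2) by blast
  qed
qed

lemma ex2_half_F5_bounds:
  shows "ex2 (1/2) n F5 \<le> n * ((n / 3) * sqrt (n / 3)) + 2 * (real n)\<^sup>2"
    and "ex2 (1/2) n F5 \<ge> 0"
proof -
  let ?A = "{norm2 (1/2) H | H :: nat hypergraph.
    three_graph H \<and> card (verts H) = n \<and> \<not> contains_copy F5 H}"
  let ?E = "\<lparr>verts = {..<n}, edges = {}\<rparr>"
  \<comment> \<open>The edgeless 3-graph shows that the maximum is over a nonempty set, and it also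
    yields nonnegativity.\<close>
  have E: "norm2 (1/2) ?E \<in> ?A"
    by (intro CollectI exI[of _ ?E]) (auto simp: three_graph_def contains_copy_def F5_def)
  then have ne: "?A \<noteq> {}" by blast
  show "ex2 (1/2) n F5 \<le> n * ((n / 3) * sqrt (n / 3)) + 2 * (real n)\<^sup>2"
    unfolding ex2_def using F5_free_norm2_half_le
    by (subst Max_le_iff[OF finite_norm2_values ne]) auto
  have "0 \<le> norm2 (1/2) ?E" by (simp add: norm2_half sum_nonneg)
  also have "\<dots> \<le> ex2 (1/2) n F5"
    unfolding ex2_def by (rule Max_ge[OF finite_norm2_values E])
  finally show "ex2 (1/2) n F5 \<ge> 0" .
qed

lemma exdeg2_half_F5_le:
  assumes "n = 3 * m" "m > 0"
  shows "exdeg2 (1/2) n F5 \<le> 5/2 * (m * sqrt m + 6 * m)"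
proof -
  have m: "real n / 3 = m" "n > 0" using assms by auto
  have "exdeg2 (1/2) n F5 = 5/2 * (ex2 (1/2) n F5 / n)" by (simp add: exdeg2_def)
  also have "ex2 (1/2) n F5 / n \<le> (n * (m * sqrt m + 6 * m)) / n"
    using ex2_half_F5_bounds(1)[of n] unfolding m(1) using assms(1)
    by (intro divide_right_mono) (auto simp: distrib_left power2_eq_square)
  also have "\<dots> = m * sqrt m + 6 * m" using m(2) by simp
  finally show ?thesis by simp
qed

subsection \<open>Lower bounds for degrees\<close>

text \<open>Deleting \<open>x\<close> loses the pairs at \<open>x\<close> entirely and lowers the
  degree of every pair in the link of \<open>x\<close> by at least one. \<open>Y\<close> and
  \<open>L\<close> may be proper subsets of what is available, so only convenient pairs have to be
  counted.\<close>

lemma degree2_half_ge: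
  assumes H: "three_graph H" and x: "x \<in> verts H"
    and Y: "Y \<subseteq> verts H - {x}"
    and L: "\<And>T. T \<in> L \<Longrightarrow> card T = 2 \<and> x \<notin> T \<and> insert x T \<in> edges H"
  shows "degree2 (1/2) H x \<ge>
    (\<Sum>y\<in>Y. sqrt (deg H {x, y})) + (\<Sum>T\<in>L. sqrt (deg H T) - sqrt (real (deg H T) - 1))"
proof -
  let ?G = "remove_vertex H x"
  have finP: "finite (pairs H)" by (rule finite_pairs[OF H])
  have finV: "finite (verts H)" by (rule finite_verts[OF H])
  have "three_graph ?G" using H by (auto simp: three_graph_def remove_vertex_def)
  have pG: "pairs ?G = {T \<in> pairs H. x \<notin> T}" by (auto simp: pairs_def remove_vertex_def)
  have LP: "L \<subseteq> pairs ?G" using L edge_subset[OF H] by (fastforce simp: pairs_def remove_vertex_def)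
  have mono: "deg ?G T \<le> deg H T" for T
    unfolding deg_def using finite_edges[OF H] by (intro card_mono) (auto simp: remove_vertex_def)
  have link: "real (deg ?G T) \<le> real (deg H T) - 1" if "T \<in> L" for T
  proof -
    have "{e \<in> edges ?G. T \<subseteq> e} \<subset> {e \<in> edges H. T \<subseteq> e}"
      using L[OF that] by (auto simp: remove_vertex_def)
    then have "deg ?G T < deg H T"
      unfolding deg_def using finite_edges[OF H] by (intro psubset_card_mono) auto
    then show ?thesis by linarith
  qed
  have "norm2 (1/2) H = (\<Sum>T\<in>pairs H - pairs ?G. sqrt (deg H T)) + (\<Sum>T\<in>pairs ?G. sqrt (deg H T))"
    unfolding norm2_half using finP pG by (intro sum.subset_diff) auto
  also have "pairs H - pairs ?G = {T. T \<subseteq> verts H \<and> card T = 2 \<and> x \<in> T}"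
    unfolding pG by (auto simp: pairs_def)
  finally have "degree2 (1/2) H x = (\<Sum>y\<in>verts H - {x}. sqrt (deg H {x, y}))
      + (\<Sum>T\<in>pairs ?G. sqrt (deg H T) - sqrt (deg ?G T))"
    unfolding degree2_def sum_pairs_through[OF finV x]
    by (simp add: norm2_half sum_subtractf)
  moreover have "(\<Sum>y\<in>Y. sqrt (deg H {x, y})) \<le> (\<Sum>y\<in>verts H - {x}. sqrt (deg H {x, y}))"
    using Y finV by (intro sum_mono2) auto
  moreover have "(\<Sum>T\<in>L. sqrt (deg H T) - sqrt (real (deg H T) - 1))
      \<le> (\<Sum>T\<in>L. sqrt (deg H T) - sqrt (deg ?G T))"
    using link by (intro sum_mono) auto
  moreover have "\<dots> \<le> (\<Sum>T\<in>pairs ?G. sqrt (deg H T) - sqrt (deg ?G T))"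
    using LP mono finP pG by (intro sum_mono2) auto
  ultimately show ?thesis by linarith
qed

text \<open>Rationalising gives \<open>1 / (sqrt d + sqrt (d - 1))\<close> for the left-hand
  side.\<close>

lemma sqrt_diff_ge:
  fixes d M :: real
  assumes "1 \<le> d" "d \<le> M"
  shows "sqrt d - sqrt (d - 1) \<ge> 1 / (2 * sqrt M)"
proof -
  have "(sqrt d - sqrt (d - 1)) * (sqrt d + sqrt (d - 1)) = 1"
    using assms by (simp add: algebra_simps)
  moreover have pos: "sqrt d + sqrt (d - 1) > 0" using assms by (intro add_pos_nonneg) auto
  ultimately have "sqrt d - sqrt (d - 1) = 1 / (sqrt d + sqrt (d - 1))" by (simp add: field_simps)
  also have "\<dots> \<ge> 1 / (2 * sqrt M)"
  proof (intro divide_left_mono mult_pos_pos pos)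
    have "sqrt d \<le> sqrt M" "sqrt (d - 1) \<le> sqrt M" using assms by auto
    then show "sqrt d + sqrt (d - 1) \<le> 2 * sqrt M" by linarith
  qed (use assms in auto)
  finally show ?thesis .
qed

text \<open>When \<open>r\<close> and \<open>M\<close> are both asymptotic to a third of the number
  of vertices, the two terms have coefficients 2 and 1/2. Together they match the main term
  \<open>5/2 * m * sqrt m\<close> of \<open>exdeg2\<close>.\<close>

lemma degree2_half_ge_dense:
  fixes r M :: nat
  assumes H: "three_graph H" and x: "x \<in> verts H"
    and Y: "Y \<subseteq> verts H - {x}" "card Y \<ge> 2 * r" "\<And>y. y \<in> Y \<Longrightarrow> deg H {x, y} \<ge> r"
    and L: "\<And>T. T \<in> L \<Longrightarrow> card T = 2 \<and> x \<notin> T \<and> insert x T \<in> edges H"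
    and "card L \<ge> r * r" and "\<And>T. T \<in> L \<Longrightarrow> deg H T \<le> M" and "r \<le> M" "M > 0"
  shows "degree2 (1/2) H x \<ge> 2 * real r * sqrt r + real r * real r / (2 * sqrt M)"
proof -
  have "2 * real r * sqrt r \<le> card Y * sqrt r" using Y(2) by (intro mult_right_mono) auto
  also have "\<dots> = (\<Sum>y\<in>Y. sqrt r)" by simp
  also have "\<dots> \<le> (\<Sum>y\<in>Y. sqrt (deg H {x, y}))" using Y(3) by (intro sum_mono) auto
  finally have 1: "2 * real r * sqrt r \<le> (\<Sum>y\<in>Y. sqrt (deg H {x, y}))" .
  have pos: "deg H T \<ge> 1" if "T \<in> L" for T
  proof -
    have "insert x T \<in> {e \<in> edges H. T \<subseteq> e}" using L[OF that] by auto
    then show ?thesis unfolding deg_def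
      using finite_edges[OF H] by (simp add: Suc_le_eq card_gt_0_iff; blast)
  qed
  have "real r * real r / (2 * sqrt M) \<le> card L * (1 / (2 * sqrt M))"
    using assms(7) by (simp add: divide_right_mono flip: of_nat_mult)
  also have "\<dots> = (\<Sum>T\<in>L. 1 / (2 * sqrt M))" by simp
  also have "\<dots> \<le> (\<Sum>T\<in>L. sqrt (deg H T) - sqrt (real (deg H T) - 1))"
    using pos assms(8) by (intro sum_mono sqrt_diff_ge) auto
  finally show ?thesis using 1 degree2_half_ge[OF H x Y(1) L] by fastforce
qed

subsection \<open>The counterexample\<close>

text \<open>Restates 3-partiteness as a rainbow 3-colouring, so that forced colours can be derived
  by arithmetic. The colouring is total: 2 is the default outside \<open>A\<close> and
  \<open>B\<close>.\<close>

lemma three_partite_colouring: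
  assumes "three_graph H" and "three_partite H"
  shows "\<exists>g :: 'a \<Rightarrow> nat. (\<forall>x. g x < 3) \<and> (\<forall>e\<in>edges H. inj_on g e)"
proof -
  obtain A B C where ABC: "A \<union> B \<union> C = verts H"
    and one: "\<And>e. e \<in> edges H \<Longrightarrow> card (e \<inter> A) = 1 \<and> card (e \<inter> B) = 1 \<and> card (e \<inter> C) = 1"
    using assms(2) unfolding three_partite_def by blast
  define g :: "'a \<Rightarrow> nat" where "g x = (if x \<in> A then 0 else if x \<in> B then 1 else 2)" for x
  have "inj_on g e" if e: "e \<in> edges H" for e
  proof (rule inj_onI)
    fix x y assume xy: "x \<in> e" "y \<in> e" "g x = g y"
    have "x \<in> A \<union> B \<union> C" "y \<in> A \<union> B \<union> C" using xy edge_subset[OF assms(1) e] ABC by auto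
    then have "\<exists>X\<in>{A, B, C}. x \<in> e \<inter> X \<and> y \<in> e \<inter> X"
      using xy by (auto simp: g_def split: if_splits)
    then obtain X where X: "X \<in> {A, B, C}" "x \<in> e \<inter> X" "y \<in> e \<inter> X" by blast
    then have "card (e \<inter> X) = 1" using one[OF e] by blast
    then obtain z where "e \<inter> X = {z}" by (auto simp: card_1_singleton_iff)
    then show "x = y" using X(2,3) by auto
  qed
  moreover have "g x < 3" for x by (simp add: g_def)
  ultimately show ?thesis by blast
qed

lemma card_doubletons:
  assumes "X \<inter> Y = {}" and "S \<subseteq> X \<times> Y"
  shows "card ((\<lambda>(x, y). {x, y}) ` S) = card S"
proof (rule card_image, rule inj_onI)
  fix s t assume st: "s \<in> S" "t \<in> S" "(\<lambda>(x, y). {x, y}) s = (\<lambda>(x, y). {x, y}) t"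
  obtain x y x' y' where "s = (x, y)" "t = (x', y')" by (metis surj_pair)
  moreover from this have "x \<in> X" "y' \<in> Y" using st assms(2) by auto
  then have "x \<noteq> y'" using assms(1) by auto
  ultimately show "s = t" using st(3) by (auto simp: doubleton_eq_iff)
qed

text \<open>The complete 3-partite 3-graph on parts \<open>A, B, C\<close>, except that the pairs in \<open>P\<close> and in \<open>Q\<close>
  have their whole link replaced by the single vertex \<open>u\<close> and \<open>w\<close>, respectively. The extra edge
  \<open>uvw\<close> is what prevents 3-partiteness.\<close>

locale private_pairs =
  fixes A B C :: "'a set" and u v w :: 'a and P Q :: "('a \<times> 'a) set"
  assumes fin: "finite A" "finite B" "finite C"
    and disj: "A \<inter> B = {}" "A \<inter> C = {}" "B \<inter> C = {}"
    and uw: "u \<notin> A \<union> B \<union> C" "w \<notin> A \<union> B \<union> C" "u \<noteq> w"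
    and v: "v \<in> B"
    and PQ: "P \<subseteq> (B - {v}) \<times> C" "Q \<subseteq> (B - {v}) \<times> C" "P \<inter> Q = {}"
    and nonempty: "A \<noteq> {}" "P \<noteq> {}" "Q \<noteq> {}"
begin

definition triple :: "'a \<Rightarrow> 'a \<Rightarrow> 'a \<Rightarrow> bool" where
  "triple a b c \<longleftrightarrow> b \<in> B \<and> c \<in> C \<and>
     (if (b, c) \<in> P then a = u else if (b, c) \<in> Q then a = w else a \<in> A)"

definition tri :: "'a set \<Rightarrow> bool" where
  "tri e \<longleftrightarrow> (\<exists>a b c. e = {a, b, c} \<and> triple a b c)"

definition G :: "'a hypergraph" where
  "G = \<lparr>verts = A \<union> B \<union> C \<union> {u, w}, edges = insert {u, v, w} {e. tri e}\<rparr>"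

text \<open>The unmodified pairs, those whose link is still all of \<open>A\<close>.\<close>

definition K :: "('a \<times> 'a) set" where
  "K = B \<times> C - (P \<union> Q)"

text \<open>The default 0 places \<open>u\<close> and \<open>w\<close> in the class of
  \<open>A\<close>. All edges except \<open>{u, v, w}\<close> are then rainbow.\<close>

definition col :: "'a \<Rightarrow> nat" where
  "col x = (if x \<in> B then 1 else if x \<in> C then 2 else 0)"

lemma edges_G: "edges G = insert {u, v, w} {e. tri e}"
  and verts_G: "verts G = A \<union> B \<union> C \<union> {u, w}"
  by (simp_all add: G_def)

lemma triple_memD:
  assumes "triple a b c"
  shows "a \<in> insert u (insert w A)" "b \<in> B" "c \<in> C"
  using assms by (auto simp: triple_def split: if_splits)

lemma triple_col:
  assumes "triple a b c"
  shows "col a = 0" "col b = 1" "col c = 2"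
  using triple_memD[OF assms] disj uw by (auto simp: col_def)

lemma triple_in_A_iff: "a \<in> A \<Longrightarrow> triple a b c \<longleftrightarrow> (b, c) \<in> K"
  using uw by (auto simp: triple_def K_def)

lemma col_less: "col x < 3" by (simp add: col_def)

lemma tri_inj_col: "tri e \<Longrightarrow> inj_on col e"
  by (auto simp: tri_def inj_on_def triple_col)

text \<open>The vertices \<open>u\<close> and \<open>w\<close> share colour 0, and an edge of this
  kind through either one uses a pair from \<open>P\<close> or \<open>Q\<close>, which avoids
  \<open>v\<close>. So the extra edge meets every other edge in at most one vertex.\<close>

lemma tri_special_unique:
  assumes "tri e" "x \<in> e" "y \<in> e" "x \<in> {u, v, w}" "y \<in> {u, v, w}"
  shows "x = y"
proof -
  obtain a b c where abc: "e = {a, b, c}" "triple a b c" using assms(1) by (auto simp: tri_def)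
  have "x \<noteq> c" "y \<noteq> c" using triple_memD[OF abc(2)] assms(4,5) uw v disj by auto
  then have "{x, y} \<subseteq> {a, b}" using assms(2,3) abc(1) by auto
  moreover have False if "a \<in> {u, w}" "b = v"
    using abc(2) that PQ uw by (auto simp: triple_def split: if_splits)
  moreover have "a \<noteq> v" using triple_memD(1)[OF abc(2)] uw v disj by auto
  moreover have "b \<notin> {u, w}" using triple_memD(2)[OF abc(2)] uw by auto
  ultimately show ?thesis using assms(4,5) by auto
qed

lemma triple_unique:
  assumes "triple a b c" "x \<in> {a, b, c}"
  shows "col x = 0 \<Longrightarrow> x = a" "col x = 1 \<Longrightarrow> x = b" "col x = 2 \<Longrightarrow> x = c"
  using assms triple_col[OF assms(1)] by auto

lemma tri_iff_triple:
  assumes "col a = 0" "col b = 1" "col c = 2"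
  shows "tri {a, b, c} \<longleftrightarrow> triple a b c"
proof
  assume "tri {a, b, c}"
  then obtain a' b' c' where t: "{a, b, c} = {a', b', c'}" "triple a' b' c'" by (auto simp: tri_def)
  then have "a = a'" "b = b'" "c = c'" using assms triple_unique[OF t(2)] by blast+
  with t show "triple a b c" by simp
qed (auto simp: tri_def)

lemma three_graph_G: "three_graph G"
proof -
  have "e \<subseteq> verts G \<and> card e = 3" if e: "e \<in> edges G" for e
  proof (cases "e = {u, v, w}")
    case True
    then show ?thesis using uw v by (auto simp: verts_G card_insert_if)
  next
    case False
    then obtain a b c where abc: "e = {a, b, c}" "triple a b c"
      using e unfolding edges_G tri_def by blast
    have "a \<noteq> b" "a \<noteq> c" "b \<noteq> c" using triple_col[OF abc(2)] by auto
    then show ?thesis using abc triple_memD[OF abc(2)] by (auto simp: verts_G)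
  qed
  then show ?thesis using fin by (auto simp: three_graph_def verts_G)
qed

lemma tri_remaining_colour:
  assumes "tri {p, q, r}" "tri {p, q, s}" "p \<noteq> q" "r \<notin> {p, q}" "s \<notin> {p, q}"
  shows "col r = col s"
proof -
  have "col p \<noteq> col q" "col r \<noteq> col p" "col r \<noteq> col q" "col s \<noteq> col p" "col s \<noteq> col q"
    using tri_inj_col[OF assms(1)] tri_inj_col[OF assms(2)] assms(3-5) by (auto simp: inj_on_def)
  then show ?thesis using col_less[of p] col_less[of q] col_less[of r] col_less[of s] by linarith
qed

text \<open>The pair \<open>p, q\<close> would have to lie in \<open>P\<close> to be in the link of
  \<open>u\<close> and in \<open>Q\<close> to be in the link of \<open>w\<close>, but
  \<open>P\<close> and \<open>Q\<close> are disjoint.\<close>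

lemma not_tri_both_special:
  assumes "tri {p, q, u}" "tri {p, q, w}" "p \<notin> {u, w}" "q \<notin> {u, w}"
  shows False
proof -
  have c0: "col u = 0" "col w = 0" using uw by (auto simp: col_def)
  obtain a b c where t: "{p, q, u} = {a, b, c}" "triple a b c" using assms(1) by (auto simp: tri_def)
  obtain a' b' c' where t': "{p, q, w} = {a', b', c'}" "triple a' b' c'"
    using assms(2) by (auto simp: tri_def)
  have a: "a = u" "a' = w" using triple_unique(1)[OF t(2), of u] triple_unique(1)[OF t'(2), of w] c0 t(1) t'(1)
    by auto
  have "b \<in> {p, q, u}" "c \<in> {p, q, u}" unfolding t(1) by simp_all
  moreover have "b \<noteq> u" "c \<noteq> u" using triple_col[OF t(2)] c0 by auto
  ultimately have "b \<in> {a', b', c'}" "c \<in> {a', b', c'}" unfolding t'(1)[symmetric] by auto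
  then have "b = b'" "c = c'" using triple_unique(2)[OF t'(2), of b] triple_unique(3)[OF t'(2), of c] triple_col[OF t(2)] by simp_all
  then show False using t(2) t'(2) a uw by (auto simp: triple_def split: if_splits)
qed

lemma G_F5_free: "\<not> contains_copy F5 G"
proof
  assume "contains_copy F5 G"
  then obtain f :: "nat \<Rightarrow> 'a" where f: "inj_on f {1, 2, 3, 4, 5}"
    and E: "\<forall>e\<in>{{1, 2, 3}, {1, 2, 4}, {3, 4, 5}}. f ` e \<in> edges G"
    by (auto simp: contains_copy_def F5_def)
  define p q r s t where "p = f 1" and "q = f 2" and "r = f 3" and "s = f 4" and "t = f 5"
  note defs = p_def q_def r_def s_def t_def
  have dist: "distinct [p, q, r, s, t]" using f by (auto simp: defs inj_on_def)
  have pqr: "{p, q, r} \<in> edges G" and pqs: "{p, q, s} \<in> edges G" and rst: "{r, s, t} \<in> edges G"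
    using E by (auto simp: defs)
  let ?e = "{u, v, w}"
  \<comment> \<open>The extra edge cannot be one of the two edges of the copy that share
    \<open>p, q\<close>. Hence both are rainbow, which forces \<open>r\<close> and \<open>s\<close>
    to have the same colour.\<close>
  have pair: False if xyz: "{p, q, x} = ?e" "tri {p, q, y}" for x y
    using tri_special_unique[OF xyz(2), of p q] xyz(1) dist by auto
  have "tri {p, q, r} \<or> tri {p, q, s}"
  proof (rule ccontr)
    assume "\<not> ?thesis"
    then have "{p, q, r} = {p, q, s}" using pqr pqs by (auto simp: edges_G)
    then show False using dist by auto
  qed
  then have t1: "tri {p, q, r}" "tri {p, q, s}"
    using pair pqr pqs by (auto simp: edges_G)
  have rs: "col r = col s" by (rule tri_remaining_colour[OF t1]) (use dist in auto)
  show False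
  proof (cases "tri {r, s, t}")
    case True
    then show False using inj_onD[OF tri_inj_col[OF True] rs] dist by simp
  next
    case False
    \<comment> \<open>Only the extra edge contains two vertices of equal colour, namely
      \<open>u\<close> and \<open>w\<close>; thus \<open>p, q\<close> would be in the links of
      both.\<close>
    then have e: "{r, s, t} = ?e" using rst by (auto simp: edges_G)
    have "col u = 0" "col w = 0" "col v = 1" using uw v by (auto simp: col_def)
    moreover have "r \<in> ?e" "s \<in> ?e" "r \<noteq> s" using dist unfolding e[symmetric] by auto
    ultimately have "r = u \<and> s = w \<or> r = w \<and> s = u" using rs by auto
    moreover have "p \<notin> ?e" "q \<notin> ?e" using dist unfolding e[symmetric] by auto
    ultimately show False using t1 not_tri_both_special[of p q] by auto
  qed
qed

section \<open>3-partiteness with and without the vertex \<open>v\<close>\<close>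

lemma tri_v: "a \<in> A \<Longrightarrow> c \<in> C \<Longrightarrow> tri {a, v, c}"
proof -
  assume "a \<in> A" "c \<in> C"
  then have "triple a v c" using v PQ by (auto simp: triple_def)
  then show ?thesis by (auto simp: tri_def)
qed

text \<open>Since \<open>P\<close> and \<open>Q\<close> avoid \<open>v\<close>, the edges
  \<open>avc\<close> and \<open>avc'\<close> exist and force \<open>c\<close> and \<open>c'\<close>
  to have equal colour. Then \<open>u\<close> and \<open>w\<close> are both left with the third
  colour, contradicting the edge \<open>uvw\<close>.\<close>

lemma G_not_three_partite: "\<not> three_partite G"
proof
  assume "three_partite G"
  then obtain g :: "'a \<Rightarrow> nat" where g: "\<And>x. g x < 3" "\<And>e. e \<in> edges G \<Longrightarrow> inj_on g e"
    using three_partite_colouring[OF three_graph_G] by blast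
  obtain a where a: "a \<in> A" using nonempty by blast
  obtain b c where bc: "(b, c) \<in> P" using nonempty by auto
  obtain b' c' where bc': "(b', c') \<in> Q" using nonempty by auto
  have C: "c \<in> C" "c' \<in> C" using bc bc' PQ by auto
  have "triple u b c" "triple w b' c'" using bc bc' PQ by (auto simp: triple_def)
  then have E: "{u, b, c} \<in> edges G" "{w, b', c'} \<in> edges G" "{u, v, w} \<in> edges G"
      "{a, v, c} \<in> edges G" "{a, v, c'} \<in> edges G"
    using tri_v[OF a] C by (auto simp: edges_G tri_def)
  have ne: "u \<noteq> c" "w \<noteq> c'" "u \<noteq> v" "w \<noteq> v" "a \<noteq> v" "a \<noteq> c" "a \<noteq> c'" "v \<noteq> c" "v \<noteq> c'"
    using uw C a v disj by auto
  have "g u \<noteq> g c" "g w \<noteq> g c'" "g u \<noteq> g v" "g w \<noteq> g v" "g u \<noteq> g w"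
      "g a \<noteq> g v" "g a \<noteq> g c" "g v \<noteq> g c" "g a \<noteq> g c'" "g v \<noteq> g c'"
    using g(2)[OF E(1)] g(2)[OF E(2)] g(2)[OF E(3)] g(2)[OF E(4)] g(2)[OF E(5)] uw(3) ne
    by (simp_all add: inj_on_def)
  note ne_g = this
  have "g c = g c'"
    using ne_g(6-10) g(1)[of v] g(1)[of a] g(1)[of c] g(1)[of c'] by linarith
  then have "g u = g w"
    using ne_g(1-4,8) g(1)[of u] g(1)[of v] g(1)[of w] g(1)[of c] by linarith
  then show False using ne_g(5) by simp
qed

lemma remove_v_three_partite: "remove_vertex G v \<in> three_partite_graphs"
proof -
  let ?H = "remove_vertex G v"
  have "three_graph ?H" using three_graph_G by (auto simp: three_graph_def remove_vertex_def)
  moreover have "three_partite ?H"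
    unfolding three_partite_def
  proof (intro exI conjI ballI)
    let ?A = "A \<union> {u, w}"
    show "?A \<union> (B - {v}) \<union> C = verts ?H" "?A \<inter> (B - {v}) = {}" "?A \<inter> C = {}" "(B - {v}) \<inter> C = {}"
      using uw v disj by (auto simp: remove_vertex_def verts_G)
    fix e assume "e \<in> edges ?H"
    then obtain a b c where abc: "e = {a, b, c}" "triple a b c" "v \<notin> e"
      by (auto simp: remove_vertex_def edges_G tri_def)
    have "e \<inter> ?A = {a}" "e \<inter> (B - {v}) = {b}" "e \<inter> C = {c}"
      using triple_memD[OF abc(2)] abc(1,3) uw disj by auto
    then show "card (e \<inter> ?A) = 1" "card (e \<inter> (B - {v})) = 1" "card (e \<inter> C) = 1" by simp_all
  qed
  ultimately show ?thesis by (simp add: three_partite_graphs_def)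
qed

section \<open>Codegrees and vertex degrees in the construction\<close>

lemma tri_other_colour: "tri {x, y, z} \<Longrightarrow> x \<notin> {y, z} \<Longrightarrow> col x \<noteq> col y \<and> col x \<noteq> col z"
  by (drule tri_inj_col) (auto simp: inj_on_def)

text \<open>A pair not contained in \<open>{u, v, w}\<close> does not see the extra edge. In the
  next three lemmas the colours of the pair determine the colour, and hence the role, of the third
  vertex.\<close>

lemma deg_eq_card_tri:
  assumes "y \<noteq> z" and "\<not> {y, z} \<subseteq> {u, v, w}"
  shows "deg G {y, z} = card {x. x \<notin> {y, z} \<and> tri {x, y, z}}"
proof -
  have "{x, y, z} \<noteq> {u, v, w}" for x using assms(2) by blast
  then show ?thesis
    using deg_eq_card_link[OF three_graph_G, of "{y, z}"] assms(1) by (simp add: edges_G)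
qed

lemma deg_AB:
  assumes "a \<in> A" "b \<in> B"
  shows "deg G {a, b} = card {c. (b, c) \<in> K}"
proof -
  have col: "col a = 0" "col b = 1" using assms disj by (auto simp: col_def)
  have "x \<notin> {a, b} \<and> tri {x, a, b} \<longleftrightarrow> triple a b x" for x
  proof
    assume x: "x \<notin> {a, b} \<and> tri {x, a, b}"
    then have "col x = 2" using tri_other_colour[of x a b] col col_less[of x] by auto
    then show "triple a b x" using x col tri_iff_triple[of a b x] by (simp add: insert_commute)
  next
    assume t: "triple a b x"
    then have "col x = 2" by (rule triple_col)
    then show "x \<notin> {a, b} \<and> tri {x, a, b}"
      using t col tri_iff_triple[of a b x] by (auto simp: insert_commute)
  qed
  moreover have "a \<noteq> b" using col by auto
  moreover have "\<not> {a, b} \<subseteq> {u, v, w}" using assms uw v disj by auto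
  ultimately show ?thesis using assms by (simp add: deg_eq_card_tri triple_in_A_iff)
qed

lemma deg_AC:
  assumes "a \<in> A" "c \<in> C"
  shows "deg G {a, c} = card {b. (b, c) \<in> K}"
proof -
  have col: "col a = 0" "col c = 2" using assms disj by (auto simp: col_def)
  have "x \<notin> {a, c} \<and> tri {x, a, c} \<longleftrightarrow> triple a x c" for x
  proof
    assume x: "x \<notin> {a, c} \<and> tri {x, a, c}"
    then have "col x = 1" using tri_other_colour[of x a c] col col_less[of x] by auto
    then show "triple a x c" using x col tri_iff_triple[of a x c] by (simp add: insert_commute)
  next
    assume t: "triple a x c"
    then have "col x = 1" by (rule triple_col)
    then show "x \<notin> {a, c} \<and> tri {x, a, c}"
      using t col tri_iff_triple[of a x c] by (auto simp: insert_commute)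
  qed
  moreover have "a \<noteq> c" using col by auto
  moreover have "\<not> {a, c} \<subseteq> {u, v, w}" using assms uw v disj by auto
  ultimately show ?thesis using assms by (simp add: deg_eq_card_tri triple_in_A_iff)
qed

lemma deg_BC:
  assumes "b \<in> B" "c \<in> C"
  shows "deg G {b, c} = card {a. triple a b c}"
proof -
  have col: "col b = 1" "col c = 2" using assms disj by (auto simp: col_def)
  have "x \<notin> {b, c} \<and> tri {x, b, c} \<longleftrightarrow> triple x b c" for x
  proof
    assume x: "x \<notin> {b, c} \<and> tri {x, b, c}"
    then have "col x = 0" using tri_other_colour[of x b c] col col_less[of x] by auto
    then show "triple x b c" using x col tri_iff_triple[of x b c] by simp
  next
    assume t: "triple x b c"
    then have "col x = 0" by (rule triple_col)
    then show "x \<notin> {b, c} \<and> tri {x, b, c}"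
      using t col tri_iff_triple[of x b c] by auto
  qed
  moreover have "b \<noteq> c" using col by auto
  moreover have "\<not> {b, c} \<subseteq> {u, v, w}" using assms uw v disj by auto
  ultimately show ?thesis by (simp add: deg_eq_card_tri)
qed

lemma deg_K: "(b, c) \<in> K \<Longrightarrow> deg G {b, c} = card A"
  using deg_BC[of b c] by (auto simp: K_def triple_def)

lemma tri_K: "a \<in> A \<Longrightarrow> (b, c) \<in> K \<Longrightarrow> {a, b, c} \<in> edges G"
  by (auto simp: edges_G tri_def triple_in_A_iff[symmetric])

text \<open>Removing \<open>z\<close> uncovers all pairs of which it is the only neighbour.\<close>

lemma degree2_ge_private:
  assumes z: "z \<in> verts G" "z \<notin> B \<union> C" and S: "S \<subseteq> B \<times> C"
    and uniq: "\<And>a b c. (b, c) \<in> S \<Longrightarrow> triple a b c \<longleftrightarrow> a = z"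
  shows "degree2 (1/2) G z \<ge> card S"
proof -
  let ?L = "(\<lambda>(b, c). {b, c}) ` S"
  have deg1: "deg G {b, c} = 1" if "(b, c) \<in> S" for b c
    using deg_BC[of b c] that S uniq[OF that] by auto
  have "(\<Sum>T\<in>?L. sqrt (deg G T) - sqrt (real (deg G T) - 1)) = (\<Sum>T\<in>?L. 1)"
    by (rule sum.cong) (auto simp: deg1)
  also have "\<dots> = card S" using card_doubletons[OF disj(3) S] by simp
  finally have "card S = (\<Sum>T\<in>?L. sqrt (deg G T) - sqrt (real (deg G T) - 1))" ..
  moreover have "card T = 2 \<and> z \<notin> T \<and> insert z T \<in> edges G" if T: "T \<in> ?L" for T
  proof -
    obtain b c where bc: "T = {b, c}" "(b, c) \<in> S" using T by auto
    then have "b \<in> B" "c \<in> C" using S by auto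
    moreover from this have "b \<noteq> c" using disj by auto
    moreover have "tri {z, b, c}" unfolding tri_def using uniq[OF bc(2)] by blast
    ultimately show ?thesis using bc(1) z(2) by (auto simp: edges_G)
  qed
  ultimately show ?thesis using degree2_half_ge[OF three_graph_G z(1), of "{}" ?L] by simp
qed

lemma degree2_u: "degree2 (1/2) G u \<ge> card P"
  by (rule degree2_ge_private) (use uw PQ in \<open>auto simp: verts_G triple_def\<close>)

lemma degree2_w: "degree2 (1/2) G w \<ge> card Q"
  by (rule degree2_ge_private) (use uw PQ in \<open>auto simp: verts_G triple_def\<close>)

text \<open>Only edges \<open>{a, b, c}\<close> with \<open>a\<close> in \<open>A\<close> and
  \<open>(b, c)\<close> in \<open>K\<close> are used. For \<open>x\<close> in \<open>A\<close> the
  link contains \<open>K\<close>; for \<open>x\<close> in \<open>B\<close> or \<open>C\<close> it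
  contains the product of \<open>A\<close> with the \<open>K\<close>-neighbours of \<open>x\<close>.
  Either way there are at least \<open>r * r\<close> pairs, and at least \<open>2 * r\<close>
  vertices of codegree at least \<open>r\<close> with \<open>x\<close>.\<close>

lemma degree2_ABC:
  assumes x: "x \<in> A \<union> B \<union> C"
    and M: "card A \<le> M" "card B \<le> M" "card C \<le> M"
    and rA: "r \<le> card A"
    and rB: "\<And>c. c \<in> C \<Longrightarrow> r \<le> card {b. (b, c) \<in> K}"
    and rC: "\<And>b. b \<in> B \<Longrightarrow> r \<le> card {c. (b, c) \<in> K}"
  shows "degree2 (1/2) G x \<ge> 2 * real r * sqrt r + real r * real r / (2 * sqrt M)"
proof -
  have KB: "{b. (b, c) \<in> K} \<subseteq> B" and KC: "{c. (b, c) \<in> K} \<subseteq> C" for b c by (auto simp: K_def)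
  have cKB: "card {b. (b, c) \<in> K} \<le> card B" and cKC: "card {c. (b, c) \<in> K} \<le> card C" for b c
    using card_mono[OF fin(2) KB] card_mono[OF fin(3) KC] by auto
  have rBC: "r \<le> card C" using rC[OF v] cKC[of v] by simp
  have "C \<noteq> {}" using nonempty PQ by auto
  then have rBB: "r \<le> card B" using rB cKB by (meson ex_in_conv le_trans)
  have AM: "r \<le> M" "M > 0" using rA M(1) nonempty(1) fin(1) by (auto simp: card_gt_0_iff order.strict_trans2)
  have dAB: "deg G {a, b} \<le> M" if "a \<in> A" "b \<in> B" for a b
    using deg_AB[OF that] cKC[of b] M(3) by simp
  have dAC: "deg G {a, c} \<le> M" if "a \<in> A" "c \<in> C" for a c
    using deg_AC[OF that] cKB[of c] M(2) by simp
  note dense = degree2_half_ge_dense[OF three_graph_G, where r = r and M = M]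
  consider "x \<in> A" | "x \<in> B" | "x \<in> C" using x by blast
  then show ?thesis
  proof cases
    case 1
    have "card K = card (SIGMA b:B. {c. (b, c) \<in> K})"
      by (rule arg_cong[of _ _ card]) (auto simp: K_def)
    also have "\<dots> = (\<Sum>b\<in>B. card {c. (b, c) \<in> K})"
      using fin finite_subset[OF KC] by (intro card_SigmaI) auto
    also have "\<dots> \<ge> card B * r" using sum_mono[of B "\<lambda>_. r", OF rC] by simp
    finally have "r * r \<le> card K" using rBB mult_le_mono1 order_trans by blast
    then have card: "r * r \<le> card ((\<lambda>(b, c). {b, c}) ` K)"
      using card_doubletons[of B C K] disj by (auto simp: K_def)
    show ?thesis
    proof (rule dense[where Y = "B \<union> C" and L = "(\<lambda>(b, c). {b, c}) ` K"])
      show "x \<in> verts G" "B \<union> C \<subseteq> verts G - {x}" using 1 disj by (auto simp: verts_G)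
      show "2 * r \<le> card (B \<union> C)" using rBB rBC fin disj by (simp add: card_Un_disjoint)
      show "r \<le> deg G {x, y}" if "y \<in> B \<union> C" for y
        using that 1 rB rC by (auto simp: deg_AB deg_AC)
      show "card T = 2 \<and> x \<notin> T \<and> insert x T \<in> edges G" if "T \<in> (\<lambda>(b, c). {b, c}) ` K" for T
        using that 1 disj tri_K by (auto simp: K_def card_insert_if)
      show "deg G T \<le> M" if "T \<in> (\<lambda>(b, c). {b, c}) ` K" for T
        using that M by (auto simp: deg_K)
    qed (use card AM in auto)
  next
    case 2
    let ?N = "{c. (x, c) \<in> K}"
    have N: "?N \<subseteq> C" "finite ?N" using KC fin(3) finite_subset by blast+
    have AN: "A \<times> ?N \<subseteq> A \<times> C" using N(1) by blast
    have card: "r * r \<le> card ((\<lambda>(a, c). {a, c}) ` (A \<times> ?N))"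
      using card_doubletons[OF disj(2) AN] mult_le_mono[OF rA rC[OF 2]]
      by (simp add: card_cartesian_product)
    show ?thesis
    proof (rule dense[where Y = "A \<union> ?N" and L = "(\<lambda>(a, c). {a, c}) ` (A \<times> ?N)"])
      show "x \<in> verts G" "A \<union> ?N \<subseteq> verts G - {x}" using 2 N(1) disj by (auto simp: verts_G)
      have "A \<inter> ?N = {}" using N(1) disj by auto
      then show "2 * r \<le> card (A \<union> ?N)" using rA rC[OF 2] fin N(2) by (simp add: card_Un_disjoint)
      show "r \<le> deg G {x, y}" if "y \<in> A \<union> ?N" for y
        using that 2 rA rC[OF 2] deg_AB[of y x] by (auto simp: deg_K insert_commute)
      show "card T = 2 \<and> x \<notin> T \<and> insert x T \<in> edges G"
        if T: "T \<in> (\<lambda>(a, c). {a, c}) ` (A \<times> ?N)" for T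
      proof -
        obtain a c where ac: "T = {a, c}" "a \<in> A" "(x, c) \<in> K" using T by auto
        then have "a \<noteq> c" "x \<noteq> a" "x \<noteq> c" using 2 N(1) disj by auto
        then show ?thesis using ac tri_K[OF ac(2,3)] by (auto simp: insert_commute)
      qed
      show "deg G T \<le> M" if "T \<in> (\<lambda>(a, c). {a, c}) ` (A \<times> ?N)" for T
        using that by (auto simp: K_def intro!: dAC)
    qed (use card AM in auto)
  next
    case 3
    let ?N = "{b. (b, x) \<in> K}"
    have N: "?N \<subseteq> B" "finite ?N" using KB fin(2) finite_subset by blast+
    have AN: "A \<times> ?N \<subseteq> A \<times> B" using N(1) by blast
    have card: "r * r \<le> card ((\<lambda>(a, b). {a, b}) ` (A \<times> ?N))"
      using card_doubletons[OF disj(1) AN] mult_le_mono[OF rA rB[OF 3]]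
      by (simp add: card_cartesian_product)
    show ?thesis
    proof (rule dense[where Y = "A \<union> ?N" and L = "(\<lambda>(a, b). {a, b}) ` (A \<times> ?N)"])
      show "x \<in> verts G" "A \<union> ?N \<subseteq> verts G - {x}" using 3 N(1) disj by (auto simp: verts_G)
      have "A \<inter> ?N = {}" using N(1) disj by auto
      then show "2 * r \<le> card (A \<union> ?N)" using rA rB[OF 3] fin N(2) by (simp add: card_Un_disjoint)
      show "r \<le> deg G {x, y}" if "y \<in> A \<union> ?N" for y
        using that 3 rA rB[OF 3] deg_AC[of y x] deg_K[of y x] by (auto simp: insert_commute)
      show "card T = 2 \<and> x \<notin> T \<and> insert x T \<in> edges G"
        if T: "T \<in> (\<lambda>(a, b). {a, b}) ` (A \<times> ?N)" for T
      proof -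
        obtain a b where ab: "T = {a, b}" "a \<in> A" "(b, x) \<in> K" using T by auto
        then have "a \<noteq> b" "x \<noteq> a" "x \<noteq> b" using 3 N(1) disj by auto
        then show ?thesis using ab tri_K[OF ab(2,3)] by (auto simp: insert_commute)
      qed
      show "deg G T \<le> M" if "T \<in> (\<lambda>(a, b). {a, b}) ` (A \<times> ?N)" for T
        using that by (auto simp: K_def intro!: dAB)
    qed (use card AM in auto)
  qed
qed

lemma min_degree2_ge:
  assumes "card A \<le> M" "card B \<le> M" "card C \<le> M"
    and "r \<le> card A"
    and "\<And>c. c \<in> C \<Longrightarrow> r \<le> card {b. (b, c) \<in> K}"
    and "\<And>b. b \<in> B \<Longrightarrow> r \<le> card {c. (b, c) \<in> K}"
    and "D \<le> 2 * real r * sqrt r + real r * real r / (2 * sqrt M)" "D \<le> card P" "D \<le> card Q"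
  shows "D \<le> min_degree2 (1/2) G"
proof -
  have "D \<le> degree2 (1/2) G x" if "x \<in> verts G" for x
  proof (cases "x \<in> A \<union> B \<union> C")
    case True
    from degree2_ABC[OF this assms(1-6)] assms(7) show ?thesis by simp
  next
    case False
    with that degree2_u degree2_w assms(8,9) show ?thesis by (auto simp: verts_G)
  qed
  moreover have "finite (verts G)" "verts G \<noteq> {}" using fin by (auto simp: verts_G)
  ultimately show ?thesis by (simp add: min_degree2_def)
qed

end

section \<open>Concrete block construction and asymptotic estimates\<close>

text \<open>Vertex \<open>(l, i)\<close> of a part lies in block \<open>l\<close>; the private pairs join vertices of \<open>B\<close> and \<open>C\<close> in
  the same block, and belong to \<open>P\<close> or \<open>Q\<close> depending on the position of the vertex of \<open>C\<close>.\<close>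

lemma private_pairs_exists:
  fixes L s :: nat
  assumes "L > 0" "s > 0"
  defines "q \<equiv> 2 * s * L"
  shows "\<exists>(A :: nat set) B C u v w P Q. private_pairs A B C u v w P Q \<and>
    card A = q \<and> card B = q + 1 \<and> card C = q \<and> card P = q * s \<and> card Q = q * s \<and>
    (\<forall>b\<in>B. card {c. (b, c) \<in> P \<union> Q} \<le> 2 * s) \<and> (\<forall>c\<in>C. card {b. (b, c) \<in> P \<union> Q} \<le> 2 * s)"
proof -
  \<comment> \<open>An injective code for part \<open>j\<close>, block \<open>l\<close>, position
    \<open>i\<close>; label 3 is reserved for \<open>u\<close> and \<open>w\<close>.\<close>
  define \<phi> :: "nat \<Rightarrow> nat \<Rightarrow> nat \<Rightarrow> nat" where "\<phi> j l i = prod_encode (j, prod_encode (l, i))" for j l i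
  have \<phi>: "\<phi> j l i = \<phi> j' l' i' \<longleftrightarrow> j = j' \<and> l = l' \<and> i = i'" for j l i j' l' i'
    by (simp add: \<phi>_def prod_encode_eq)
  define part where "part j = (\<lambda>(l, i). \<phi> j l i) ` ({..<L} \<times> {..<2 * s})" for j
  define joins where "joins J = (\<lambda>(l, i, j). (\<phi> 1 l i, \<phi> 2 l j)) ` ({..<L} \<times> {..<2 * s} \<times> J)" for J
  define A where "A = part 0"
  \<comment> \<open>The additional vertex serves as \<open>v\<close>. Its block index
    \<open>L\<close> is one past the last block, so no private pair contains it.\<close>
  define B where "B = insert (\<phi> 1 L 0) (part 1)"
  define C where "C = part 2"
  define P where "P = joins {..<s}"
  define Q where "Q = joins {s..<2 * s}"
  have fin: "finite (part j)" for j by (simp add: part_def)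
  have card_part: "card (part j) = q" for j
    unfolding part_def q_def by (subst card_image) (auto simp: inj_on_def \<phi>)
  have card_joins: "card (joins J) = q * card J" for J
    unfolding joins_def q_def by (subst card_image) (auto simp: inj_on_def \<phi> card_cartesian_product)
  have v: "\<phi> 1 L 0 \<notin> part 1" by (auto simp: part_def \<phi>)
  have joins_sub: "joins J \<subseteq> part 1 \<times> part 2" if "J \<subseteq> {..<2 * s}" for J
    using that by (auto simp: joins_def part_def)
  have sub: "P \<subseteq> part 1 \<times> part 2" "Q \<subseteq> part 1 \<times> part 2"
    unfolding P_def Q_def by (rule joins_sub; auto)+
  have pos: "q * s > 0" using assms by (simp add: q_def)
  have cards: "card A = q" "card B = q + 1" "card C = q" "card P = q * s" "card Q = q * s"
    using fin v by (simp_all add: A_def B_def C_def P_def Q_def card_part card_joins)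
  have "private_pairs A B C (\<phi> 3 0 0) (\<phi> 1 L 0) (\<phi> 3 0 1) P Q"
  proof
    show "finite A" "finite B" "finite C" using fin by (simp_all add: A_def B_def C_def)
    show "A \<inter> B = {}" "A \<inter> C = {}" "B \<inter> C = {}" by (auto simp: A_def B_def C_def part_def \<phi>)
    show "\<phi> 3 0 0 \<notin> A \<union> B \<union> C" "\<phi> 3 0 1 \<notin> A \<union> B \<union> C" "\<phi> 3 0 0 \<noteq> \<phi> 3 0 1"
      by (auto simp: A_def B_def C_def part_def \<phi>)
    show "\<phi> 1 L 0 \<in> B" by (simp add: B_def)
    show "P \<subseteq> (B - {\<phi> 1 L 0}) \<times> C" "Q \<subseteq> (B - {\<phi> 1 L 0}) \<times> C"
      using sub v by (auto simp: B_def C_def)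
    show "P \<inter> Q = {}" by (auto simp: P_def Q_def joins_def \<phi>)
    show "A \<noteq> {}" "P \<noteq> {}" "Q \<noteq> {}" using cards pos by fastforce+
  qed
  moreover have "card {c. (b, c) \<in> P \<union> Q} \<le> 2 * s" if b: "b \<in> B" for b
  proof -
    obtain l i where bl: "b = \<phi> 1 l i" using b by (auto simp: B_def part_def)
    have "{c. (b, c) \<in> P \<union> Q} \<subseteq> \<phi> 2 l ` {..<2 * s}" by (auto simp: bl P_def Q_def joins_def \<phi>)
    then have "card {c. (b, c) \<in> P \<union> Q} \<le> card {..<2 * s}" by (rule surj_card_le[rotated]) simp
    then show ?thesis by simp
  qed
  moreover have "card {b. (b, c) \<in> P \<union> Q} \<le> 2 * s" if c: "c \<in> C" for c
  proof -
    obtain l i where cl: "c = \<phi> 2 l i" using c by (auto simp: C_def part_def)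
    have "{b. (b, c) \<in> P \<union> Q} \<subseteq> \<phi> 1 l ` {..<2 * s}" by (auto simp: cl P_def Q_def joins_def \<phi>)
    then have "card {b. (b, c) \<in> P \<union> Q} \<le> card {..<2 * s}" by (rule surj_card_le[rotated]) simp
    then show ?thesis by simp
  qed
  ultimately show ?thesis using cards by blast
qed

text \<open>With parts of size about \<open>q = 100 k\<^sup>2\<close>, each of the two private links needs at least
  \<open>5/2 q\<^sup>3\<^sup>/\<^sup>2\<close> pairs; blocks of \<open>50 k \<times> 100 k\<close> give \<open>5 q\<^sup>3\<^sup>/\<^sup>2\<close>, at a cost of \<open>100 k = o(q)\<close> neighbours
  per vertex.\<close>

lemma eventually_dense_degree:
  fixes c :: real
  assumes "c < 1"
  shows "\<forall>\<^sub>F k :: nat in sequentially.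
    let m = 100 * real k ^ 2 + 1; r = 100 * real k ^ 2 - 100 * real k in
    c * (5/2 * (m * sqrt m + 6 * m)) \<le> 2 * r * sqrt r + r * r / (2 * sqrt m)"
proof -
  \<comment> \<open>Numerator and denominator are both asymptotic to
    \<open>5/2 * m * sqrt m\<close>, because \<open>m - r\<close> and the error \<open>6 * m\<close>
    are of lower order.\<close>
  have "((\<lambda>k :: real. let m = 100 * k ^ 2 + 1; r = 100 * k ^ 2 - 100 * k in
      (2 * r * sqrt r + r * r / (2 * sqrt m)) / (5/2 * (m * sqrt m + 6 * m))) \<longlongrightarrow> 1) at_top"
    unfolding Let_def by real_asymp
  then have "((\<lambda>k. let m = 100 * real k ^ 2 + 1; r = 100 * real k ^ 2 - 100 * real k in
      (2 * r * sqrt r + r * r / (2 * sqrt m)) / (5/2 * (m * sqrt m + 6 * m))) \<longlongrightarrow> 1) sequentially"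
    by (rule filterlim_compose[OF _ filterlim_real_sequentially])
  then have "\<forall>\<^sub>F k in sequentially. c < (let m = 100 * real k ^ 2 + 1; r = 100 * real k ^ 2 - 100 * real k in
      (2 * r * sqrt r + r * r / (2 * sqrt m)) / (5/2 * (m * sqrt m + 6 * m)))"
    using assms by (rule order_tendstoD(1))
  then show ?thesis
  proof (rule eventually_mono)
    fix k
    define m where "m = 100 * real k ^ 2 + 1"
    define r where "r = 100 * real k ^ 2 - 100 * real k"
    have "m > 0" unfolding m_def by (rule add_nonneg_pos) auto
    then have "5/2 * (m * sqrt m + 6 * m) > 0" by (intro mult_pos_pos add_pos_pos) auto
    moreover assume "c < (let m = 100 * real k ^ 2 + 1; r = 100 * real k ^ 2 - 100 * real k in
      (2 * r * sqrt r + r * r / (2 * sqrt m)) / (5/2 * (m * sqrt m + 6 * m)))"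
    then have "c < (2 * r * sqrt r + r * r / (2 * sqrt m)) / (5/2 * (m * sqrt m + 6 * m))"
      by (simp only: Let_def m_def r_def)
    ultimately have "c * (5/2 * (m * sqrt m + 6 * m)) \<le> 2 * r * sqrt r + r * r / (2 * sqrt m)"
      by (simp only: pos_less_divide_eq less_imp_le)
    then show "let m = 100 * real k ^ 2 + 1; r = 100 * real k ^ 2 - 100 * real k in
      c * (5/2 * (m * sqrt m + 6 * m)) \<le> 2 * r * sqrt r + r * r / (2 * sqrt m)"
      by (simp only: Let_def m_def r_def)
  qed
qed

text \<open>The leading terms are \<open>2500 * k ^ 3\<close> on the left and
  \<open>5000 * k ^ 3\<close> on the right.\<close>

lemma eventually_private_degree:
  "\<forall>\<^sub>F k :: nat in sequentially.
    let m = 100 * real k ^ 2 + 1 in 5/2 * (m * sqrt m + 6 * m) \<le> 100 * real k ^ 2 * (50 * real k)"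
proof -
  have "\<forall>\<^sub>F k :: real in at_top.
    let m = 100 * k ^ 2 + 1 in 5/2 * (m * sqrt m + 6 * m) \<le> 100 * k ^ 2 * (50 * k)"
    unfolding Let_def by real_asymp
  then show ?thesis by (rule eventually_compose_filterlim[OF _ filterlim_real_sequentially])
qed

section \<open>Choice of parameters and conclusion\<close>

theorem theoremA1:
  shows "\<not> vertex_extendable2 (1/2) F5 three_partite_graphs"
proof
  assume "vertex_extendable2 (1/2) F5 three_partite_graphs"
  then obtain \<epsilon> :: real and N\<^sub>0 :: nat where eps: "\<epsilon> > 0"
    and ext: "\<And>H :: nat hypergraph. three_graph H \<Longrightarrow> \<not> contains_copy F5 H \<Longrightarrow> card (verts H) \<ge> N\<^sub>0 \<Longrightarrow>
      min_degree2 (1/2) H \<ge> (1 - \<epsilon>) * exdeg2 (1/2) (card (verts H)) F5 \<Longrightarrow>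
      \<exists>v\<in>verts H. remove_vertex H v \<in> three_partite_graphs \<Longrightarrow> H \<in> three_partite_graphs"
    unfolding vertex_extendable2_def by blast
  \<comment> \<open>Since \<epsilon> may exceed 1, truncating at 0 keeps multiplication by
    \<open>c\<close> monotone.\<close>
  define c where "c = max 0 (1 - \<epsilon>)"
  have c: "0 \<le> c" "c < 1" "1 - \<epsilon> \<le> c" using eps by (auto simp: c_def)
  obtain k :: nat where k: "k \<ge> N\<^sub>0" "k \<ge> 1"
    and dense: "let m = 100 * real k ^ 2 + 1; r = 100 * real k ^ 2 - 100 * real k in
      c * (5/2 * (m * sqrt m + 6 * m)) \<le> 2 * r * sqrt r + r * r / (2 * sqrt m)"
    and priv: "let m = 100 * real k ^ 2 + 1 in 5/2 * (m * sqrt m + 6 * m) \<le> 100 * real k ^ 2 * (50 * real k)"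
    using eventually_happens'[OF sequentially_bot eventually_conj[OF eventually_ge_at_top[of N\<^sub>0]
      eventually_conj[OF eventually_ge_at_top[of 1] eventually_conj[OF eventually_dense_degree[OF c(2)]
      eventually_private_degree]]]] by blast
  \<comment> \<open>\<open>m\<close> is both the largest part size and a third of the number of
    vertices, as \<open>q + (q + 1) + q + 2 = 3 * m\<close>. \<open>r\<close> is what remains after
    each vertex loses at most \<open>100 * k\<close> neighbours to private pairs.\<close>
  define q m r where "q = 100 * k\<^sup>2" and "m = q + 1" and "r = q - 100 * k"
  have kk: "k \<le> k\<^sup>2" by (simp add: power2_eq_square)
  \<comment> \<open>There are \<open>k\<close> blocks, with \<open>s = 50 * k\<close> in the block
    construction.\<close>
  have qs: "2 * (50 * k) * k = q" by (simp add: q_def power2_eq_square)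
  have real: "real m = 100 * real k ^ 2 + 1" "real r = 100 * real k ^ 2 - 100 * real k"
    using kk by (simp_all add: q_def m_def r_def of_nat_diff)
  obtain A B C :: "nat set" and u v w P Q where "private_pairs A B C u v w P Q"
    and cards: "card A = q" "card B = q + 1" "card C = q" "card P = q * (50 * k)" "card Q = q * (50 * k)"
    and nbrB: "\<forall>b\<in>B. card {c. (b, c) \<in> P \<union> Q} \<le> 100 * k"
    and nbrC: "\<forall>c\<in>C. card {b. (b, c) \<in> P \<union> Q} \<le> 100 * k"
    using private_pairs_exists[of k "50 * k"] k(2) unfolding qs by auto
  then interpret private_pairs A B C u v w P Q by simp
  have n: "card (verts G) = 3 * m"
    using fin disj uw cards by (simp add: verts_G card_Un_disjoint Int_Un_distrib2 m_def)
  define D where "D = c * (5/2 * (real m * sqrt m + 6 * real m))"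
  have "D \<le> 1 * (5/2 * (real m * sqrt m + 6 * real m))" unfolding D_def using c(2) by (intro mult_right_mono) auto
  also have "\<dots> \<le> 100 * real k ^ 2 * (50 * real k)" using priv by (simp add: Let_def real)
  finally have Dpriv: "D \<le> q * (50 * k)" by (simp add: q_def)
  have "(1 - \<epsilon>) * exdeg2 (1/2) (3 * m) F5 \<le> c * exdeg2 (1/2) (3 * m) F5"
    using c(3) ex2_half_F5_bounds(2) by (intro mult_right_mono) (auto simp: exdeg2_def)
  also have "\<dots> \<le> D"
    unfolding D_def using c(1) exdeg2_half_F5_le[of "3 * m" m] by (intro mult_left_mono) (auto simp: m_def)
  also have "D \<le> min_degree2 (1/2) G"
  proof (rule min_degree2_ge[where M = m and r = r])
    show "r \<le> card {b. (b, c) \<in> K}" if "c \<in> C" for c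
    proof -
      have "{b. (b, c) \<in> K} = B - {b. (b, c) \<in> P \<union> Q}" using that by (auto simp: K_def)
      moreover have "{b. (b, c) \<in> P \<union> Q} \<subseteq> B" using PQ by auto
      then have "finite {b. (b, c) \<in> P \<union> Q}" using fin(2) by (rule finite_subset)
      then have "card B - card {b. (b, c) \<in> P \<union> Q} \<le> card (B - {b. (b, c) \<in> P \<union> Q})"
        by (rule diff_card_le_card_Diff)
      ultimately show ?thesis using bspec[OF nbrC that] cards by (simp add: r_def)
    qed
    show "r \<le> card {c. (b, c) \<in> K}" if "b \<in> B" for b
    proof -
      have "{c. (b, c) \<in> K} = C - {c. (b, c) \<in> P \<union> Q}" using that by (auto simp: K_def)
      moreover have "{c. (b, c) \<in> P \<union> Q} \<subseteq> C" using PQ by auto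
      then have "finite {c. (b, c) \<in> P \<union> Q}" using fin(3) by (rule finite_subset)
      then have "card C - card {c. (b, c) \<in> P \<union> Q} \<le> card (C - {c. (b, c) \<in> P \<union> Q})"
        by (rule diff_card_le_card_Diff)
      ultimately show ?thesis using bspec[OF nbrB that] cards by (simp add: r_def)
    qed
    show "D \<le> 2 * real r * sqrt r + real r * real r / (2 * sqrt m)"
      using dense unfolding Let_def D_def real .
    show "D \<le> card P" "D \<le> card Q" using Dpriv cards by simp_all
  qed (simp_all add: cards m_def r_def)
  finally have deg: "(1 - \<epsilon>) * exdeg2 (1/2) (card (verts G)) F5 \<le> min_degree2 (1/2) G"
    by (simp only: n)
  have "N\<^sub>0 \<le> card (verts G)" using k(1) kk by (simp add: n m_def q_def)
  moreover have "v \<in> verts G" using v by (simp add: verts_G)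
  ultimately have "G \<in> three_partite_graphs"
    using ext[OF three_graph_G G_F5_free _ deg] remove_v_three_partite by blast
  then show False using G_not_three_partite by (simp add: three_partite_graphs_def)
qed

end
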